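(* Let $a\in\mathbb{R}$, $b,c>0$ with $b^2-24ac>0$, and let $s_\pm=\frac{b\pm\sqrt{b^2-24ac}}{4c}$. Let $n=(n_1,n_2,n_3)\in\mathbb{S}^2$ and $Q_0:=s_\pm\left(n\otimes n-\frac13Id\right)$ (for either choice of sign). Then the solution of $$\frac{d}{dt}Q=[W,Q]-\left(aQ-b\left(Q^2-\tfrac13|Q|^2Id\right)+cQ|Q|^2\right),\qquad Q(0)=Q_0,$$ is periodic in time and given by $$Q(t)=s_\pm\left(n(t)\otimes n(t)-\tfrac13Id\right),$$ with the same choice of sign, where $n(t)=(n_1\cos t+n_2\sin t,\,-n_1\sin t+n_2\cos t,\,n_3)$.
   Context: Here $Q(t)$ is a real symmetric traceless $3\times 3$ matrix, $Id$ is the $3\times3$ identity matrix, $|Q|^2=\mathrm{tr}(Q^2)$, $[W,Q]=WQ-QW$, $n\otimes n$ is the matrix with entries $n_in_j$, $\mathbb{S}^2$ is the unit sphere in $\mathbb{R}^3$, and $$W=\begin{pmatrix}0&1&0\\-1&0&0\\0&0&0\end{pmatrix}.$$ *)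

theory Defs
  imports "HOL-Analysis.Analysis"
begin

definition Q_tensors :: "(real^3^3) set" where
  "Q_tensors = {Q. transpose Q = Q \<and> trace Q = 0}"

definition W :: "real^3^3" where
  "W = vector [vector [ 0, 1, 0],
               vector [-1, 0, 0],
               vector [ 0, 0, 0]]"

definition commutator :: "real^3^3 \<Rightarrow> real^3^3 \<Rightarrow> real^3^3" where
  "commutator A B = A ** B - B ** A"

definition normsq :: "real^3^3 \<Rightarrow> real" where
  "normsq Q = trace (Q ** Q)"

definition tensor :: "real^3 \<Rightarrow> real^3 \<Rightarrow> real^3^3" where
  "tensor m n = (\<chi> i j. m $ i * n $ j)"

text \<open>The product \<open>*\<close> and the power \<open>^\<close> on \<^typ>\<open>real^3^3\<close> act componentwise,
  so the matrix product is always written with \<open>**\<close>.\<close>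

definition rhs :: "real \<Rightarrow> real \<Rightarrow> real \<Rightarrow> real^3^3 \<Rightarrow> real^3^3" where
  "rhs a b c Q = commutator W Q
     - (a *\<^sub>R Q - b *\<^sub>R (Q ** Q - (1/3 * normsq Q) *\<^sub>R mat 1) + (c * normsq Q) *\<^sub>R Q)"

text \<open>Solutions of the initial value problem on a time interval \<open>I\<close> containing 0; at an endpoint
  belonging to \<open>I\<close> the derivative is one-sided.\<close>

definition is_solution ::
  "real \<Rightarrow> real \<Rightarrow> real \<Rightarrow> real^3^3 \<Rightarrow> real set \<Rightarrow> (real \<Rightarrow> real^3^3) \<Rightarrow> bool" where
  "is_solution a b c Q0 I Q \<longleftrightarrow>
     is_interval I \<and> 0 \<in> I \<and> Q 0 = Q0 \<and>
     (\<forall>t\<in>I. Q t \<in> Q_tensors \<and>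
             (Q has_vector_derivative rhs a b c (Q t)) (at t within I))"

end

theory Submission
  imports Defs "HOL-Library.Quadratic_Discriminant"
begin

text \<open>
  Write \<open>v\<close> for the rotated vector \<open>n(t)\<close>. The evolution splits into two effects that do not
  interact on a uniaxial tensor \<open>s (v \<otimes> v - Id / 3)\<close> with a unit vector \<open>v\<close>. Because
  \<open>v \<otimes> v\<close> is idempotent with trace 1, the bulk term maps this tensor to a scalar multiple of
  itself, and for \<open>s = s\<^sub>\<plusminus>\<close> the scalar is zero (\<open>rhs_uniaxial\<close>): such tensors are critical
  points of the bulk energy, whatever the direction of \<open>v\<close>. What remains is the linear
  equation \<open>Q' = [W, Q]\<close>, and since \<open>W\<close> is antisymmetric, it holds for \<open>v \<otimes> v\<close> as soon as
  \<open>v' = W v\<close>, by the product rule and \<open>commutator_W_tensor\<close>. The flow of \<open>W\<close> is the rotation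
  about the third axis, which gives the formula for \<open>n(t)\<close> and the period \<open>2 \<pi>\<close>; being a rotation,
  it keeps \<open>v\<close> on the unit sphere, where the bulk term vanishes.

  That this curve is the only solution, on every interval around the initial time, is the usual
  Gronwall argument (\<open>ode_unique_if_lipschitz_on_bounded_sets\<close>). The right-hand side is a
  polynomial in \<open>Q\<close>, hence not globally Lipschitz, but it is Lipschitz on bounded sets. This
  suffices because two solutions stay bounded between \<open>0\<close> and any given time. The property is
  obtained from closure under sums and bounded bilinear products, out of which \<open>rhs\<close> is built.
\<close>

section \<open>Uniqueness for vector fields that are Lipschitz on bounded sets\<close>

definition lipschitz_on_bounded_sets ::
  "('a::real_normed_vector \<Rightarrow> 'b::real_normed_vector) \<Rightarrow> bool" where
  "lipschitz_on_bounded_sets F \<longleftrightarrow> (\<forall>S. bounded S \<longrightarrow> (\<exists>L. L-lipschitz_on S F))"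

lemma lipschitz_on_bounded_sets_bounded_linear:
  assumes "bounded_linear F"
  shows "lipschitz_on_bounded_sets F"
  unfolding lipschitz_on_bounded_sets_def
  by (metis assms bounded_linear.lipschitz_boundE)

lemma lipschitz_on_bounded_sets_add:
  assumes "lipschitz_on_bounded_sets F" and "lipschitz_on_bounded_sets G"
  shows "lipschitz_on_bounded_sets (\<lambda>x. F x + G x)"
  using assms lipschitz_on_add unfolding lipschitz_on_bounded_sets_def by metis

lemma lipschitz_on_bounded_sets_diff:
  assumes "lipschitz_on_bounded_sets F" and "lipschitz_on_bounded_sets G"
  shows "lipschitz_on_bounded_sets (\<lambda>x. F x - G x)"
  using assms lipschitz_on_diff unfolding lipschitz_on_bounded_sets_def by metis

lemma bounded_image_of_lipschitz_on:
  assumes "L-lipschitz_on S F" and "bounded S"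
  shows "bounded (F ` S)"
proof (cases "S = {}")
  case False
  then obtain x where x: "x \<in> S" by blast
  obtain e where e: "\<And>y. y \<in> S \<Longrightarrow> dist x y \<le> e"
    using assms(2) bounded_any_center[of S x] by blast
  have "dist (F x) (F y) \<le> L * e" if "y \<in> S" for y
    using lipschitz_onD[OF assms(1) x that] e[OF that] lipschitz_on_nonneg[OF assms(1)]
    by (meson mult_left_mono order_trans)
  then show ?thesis unfolding bounded_def by blast
qed simp

text \<open>This is the telescoping
  \<open>F x * G x - F y * G y = F x * (G x - G y) + (F x - F y) * G y\<close>,
  whose outer factors are bounded because Lipschitz maps send bounded sets to bounded sets.\<close>

lemma lipschitz_on_bounded_sets_bilinear:
  assumes "bounded_bilinear h"
    and F: "lipschitz_on_bounded_sets F" and G: "lipschitz_on_bounded_sets G"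
  shows "lipschitz_on_bounded_sets (\<lambda>x. h (F x) (G x))"
  unfolding lipschitz_on_bounded_sets_def
proof (intro allI impI)
  fix S :: "'d set" assume S: "bounded S"
  interpret h: bounded_bilinear h by fact
  obtain K where K: "K \<ge> 0" "\<And>x y. norm (h x y) \<le> norm x * norm y * K"
    using h.nonneg_bounded by blast
  obtain L M where L: "L-lipschitz_on S F" and M: "M-lipschitz_on S G"
    using F G S unfolding lipschitz_on_bounded_sets_def by metis
  have L0: "L \<ge> 0" and M0: "M \<ge> 0" using L M lipschitz_on_nonneg by blast+
  obtain A where A: "A > 0" "\<And>x. x \<in> S \<Longrightarrow> norm (F x) \<le> A"
    using bounded_image_of_lipschitz_on[OF L S] unfolding bounded_pos by blast
  obtain B where B: "B > 0" "\<And>x. x \<in> S \<Longrightarrow> norm (G x) \<le> B"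
    using bounded_image_of_lipschitz_on[OF M S] unfolding bounded_pos by blast
  have "((A * M + L * B) * K)-lipschitz_on S (\<lambda>x. h (F x) (G x))"
  proof (rule lipschitz_onI)
    fix x y assume x: "x \<in> S" and y: "y \<in> S"
    have dF: "norm (F x - F y) \<le> L * dist x y" and dG: "norm (G x - G y) \<le> M * dist x y"
      using lipschitz_onD[OF L x y] lipschitz_onD[OF M x y] by (simp_all add: dist_norm)
    have "h (F x) (G x) - h (F y) (G y) = h (F x) (G x - G y) + h (F x - F y) (G y)"
      by (simp add: h.diff_left h.diff_right)
    then have "dist (h (F x) (G x)) (h (F y) (G y))
        \<le> norm (F x) * norm (G x - G y) * K + norm (F x - F y) * norm (G y) * K"
      using K(2) by (metis add_mono dist_norm norm_triangle_le)
    also have "\<dots> \<le> A * (M * dist x y) * K + (L * dist x y) * B * K"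
      using A(2)[OF x] B(2)[OF y] dF dG A(1) B(1) K(1) L0 M0
      by (intro add_mono mult_right_mono mult_mono) auto
    finally show "dist (h (F x) (G x)) (h (F y) (G y)) \<le> (A * M + L * B) * K * dist x y"
      by (simp add: algebra_simps)
  qed (use A(1) B(1) K(1) L0 M0 in auto)
  then show "\<exists>L. L-lipschitz_on S (\<lambda>x. h (F x) (G x))" ..
qed

text \<open>Gronwall's inequality for a zero initial value: the product with the integrating factor
  \<open>exp (- K t)\<close> is nonincreasing.\<close>

lemma gronwall_zero:
  fixes f f' :: "real \<Rightarrow> real"
  assumes deriv: "\<And>t. t \<in> {0..1} \<Longrightarrow> (f has_real_derivative f' t) (at t within {0..1})"
    and le: "\<And>t. t \<in> {0..1} \<Longrightarrow> f' t \<le> K * f t"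
    and "f 0 = 0"
  shows "f 1 \<le> 0"
proof -
  define g where "g t = exp (- K * t) * f t" for t
  define g' where "g' t = exp (- K * t) * (f' t - K * f t)" for t
  have g: "(g has_derivative (\<lambda>d. g' t * d)) (at t within {0..1})" if "0 \<le> t" "t \<le> 1" for t
  proof -
    have "(g has_real_derivative g' t) (at t within {0..1})"
      unfolding g_def g'_def using that
      by (auto intro!: derivative_eq_intros deriv simp: algebra_simps)
    then show ?thesis by (simp add: has_field_derivative_def)
  qed
  obtain t where t: "t \<in> {0..1}" "g 1 - g 0 = g' t * (1 - 0)"
    using mvt_very_simple[OF zero_le_one g] by blast
  have "g' t \<le> 0"
    using le[OF t(1)] by (simp add: g'_def mult_le_0_iff)
  then have "exp (- K) * f 1 \<le> 0"
    using t(2) \<open>f 0 = 0\<close> by (simp add: g_def)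
  then show ?thesis by (simp add: mult_le_0_iff)
qed

text \<open>The squared distance of two solutions obeys a linear differential inequality, with the
  Lipschitz constant of the field on the bounded set that both solutions sweep out between times
  \<open>0\<close> and \<open>u\<close>. Running along \<open>t = r u\<close> with \<open>r \<in> [0, 1]\<close> treats positive and negative \<open>u\<close> alike.\<close>

lemma ode_unique_if_lipschitz_on_bounded_sets:
  fixes F :: "'a::real_inner \<Rightarrow> 'a" and P Q :: "real \<Rightarrow> 'a"
  assumes F: "lipschitz_on_bounded_sets F"
    and I: "is_interval I" "0 \<in> I" "u \<in> I"
    and P: "\<And>t. t \<in> I \<Longrightarrow> (P has_vector_derivative F (P t)) (at t within I)"
    and Q: "\<And>t. t \<in> I \<Longrightarrow> (Q has_vector_derivative F (Q t)) (at t within I)"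
    and "P 0 = Q 0"
  shows "P u = Q u"
proof -
  have sub: "(\<lambda>r. r * u) ` {0..1} \<subseteq> I"
  proof
    fix t assume "t \<in> (\<lambda>r. r * u) ` {0..1}"
    then obtain r where "0 \<le> r" "r \<le> 1" "t = (1 - r) *\<^sub>R 0 + r *\<^sub>R u" by auto
    then show "t \<in> I"
      using convexD_alt[OF is_interval_convex[OF I(1)] I(2,3)] by simp
  qed
  have scaled: "((\<lambda>r. R (r * u)) has_vector_derivative u *\<^sub>R F (R (r * u))) (at r within {0..1})"
    if R: "\<And>t. t \<in> I \<Longrightarrow> (R has_vector_derivative F (R t)) (at t within I)" and r: "r \<in> {0..1}"
    for R r
  proof -
    have "(R has_vector_derivative F (R (r * u))) (at (r * u) within (\<lambda>r. r * u) ` {0..1})"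
      using R[of "r * u"] sub r by (blast intro: has_vector_derivative_within_subset)
    moreover have "((\<lambda>r. r * u) has_vector_derivative u) (at r within {0..1})"
      by (auto intro!: derivative_eq_intros)
    ultimately show ?thesis
      using vector_diff_chain_within[of "\<lambda>r. r * u" u r "{0..1}" R] by (simp add: o_def)
  qed
  define p q where "p r = P (r * u)" and "q r = Q (r * u)" for r
  have p: "(p has_vector_derivative u *\<^sub>R F (p r)) (at r within {0..1})"
    and q: "(q has_vector_derivative u *\<^sub>R F (q r)) (at r within {0..1})" if "r \<in> {0..1}" for r
    using scaled[OF P that] scaled[OF Q that] by (simp_all add: p_def[abs_def] q_def[abs_def])
  have "bounded (p ` {0..1} \<union> q ` {0..1})"
    using continuous_on_vector_derivative[of "{0..1}" p, OF p]
      continuous_on_vector_derivative[of "{0..1}" q, OF q]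
    by (simp add: compact_imp_bounded compact_continuous_image)
  then obtain L where L: "L-lipschitz_on (p ` {0..1} \<union> q ` {0..1}) F"
    using F unfolding lipschitz_on_bounded_sets_def by blast
  define D where "D r = p r - q r" for r
  define f where "f r = D r \<bullet> D r" for r
  have "f 1 \<le> 0"
  proof (rule gronwall_zero)
    fix r :: real assume r: "r \<in> {0..1}"
    have "(D has_vector_derivative u *\<^sub>R (F (p r) - F (q r))) (at r within {0..1})"
      unfolding D_def[abs_def]
      using has_vector_derivative_diff[OF p[OF r] q[OF r]] by (simp add: scaleR_diff_right)
    from bounded_bilinear.has_vector_derivative[OF bounded_bilinear_inner this this]
    show "(f has_real_derivative 2 * u * (D r \<bullet> (F (p r) - F (q r)))) (at r within {0..1})"
      unfolding f_def[abs_def] has_real_derivative_iff_has_vector_derivative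
      by (simp add: inner_commute algebra_simps)
    have "norm (F (p r) - F (q r)) \<le> L * norm (D r)"
      using lipschitz_onD[OF L, of "p r" "q r"] r by (simp add: D_def dist_norm)
    then have "\<bar>D r \<bullet> (F (p r) - F (q r))\<bar> \<le> norm (D r) * (L * norm (D r))"
      by (meson Cauchy_Schwarz_ineq2 mult_left_mono norm_ge_zero order_trans)
    then have "\<bar>D r \<bullet> (F (p r) - F (q r))\<bar> \<le> L * f r"
      by (simp add: f_def dot_square_norm power2_eq_square mult.left_commute)
    then have bound: "2 * \<bar>u\<bar> * \<bar>D r \<bullet> (F (p r) - F (q r))\<bar> \<le> 2 * \<bar>u\<bar> * (L * f r)"
      by (intro mult_left_mono) auto
    have "2 * u * (D r \<bullet> (F (p r) - F (q r))) \<le> \<bar>2 * u * (D r \<bullet> (F (p r) - F (q r)))\<bar>"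
      by (rule abs_ge_self)
    also have "\<dots> \<le> (2 * \<bar>u\<bar> * L) * f r"
      using bound by (simp only: abs_mult abs_numeral mult.assoc)
    finally show "2 * u * (D r \<bullet> (F (p r) - F (q r))) \<le> (2 * \<bar>u\<bar> * L) * f r" .
  next
    show "f 0 = 0" using \<open>P 0 = Q 0\<close> by (simp add: f_def D_def p_def q_def)
  qed
  then have "D 1 = 0" by (simp add: f_def flip: power2_norm_eq_inner)
  then show ?thesis by (simp add: D_def p_def q_def)
qed

section \<open>The Q-tensor equation and its rotating uniaxial solutions\<close>

lemma bounded_bilinear_matrix_mult:
  "bounded_bilinear ((**) :: real^'k^'m \<Rightarrow> real^'n^'k \<Rightarrow> real^'n^'m)"
  unfolding bilinear_conv_bounded_bilinear[symmetric] bilinear_def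
  by (auto intro!: linearI simp: matrix_add_ldistrib matrix_matrix_mult_def vec_eq_iff
      sum.distrib sum_distrib_left algebra_simps)

lemma linear_trace: "linear (trace :: real^'n^'n \<Rightarrow> real)"
  by (auto intro!: linearI simp: trace_def sum.distrib sum_distrib_left)

lemma bounded_bilinear_tensor: "bounded_bilinear tensor"
  unfolding bilinear_conv_bounded_bilinear[symmetric] bilinear_def
  by (auto intro!: linearI simp: tensor_def vec_eq_iff algebra_simps)

lemma lipschitz_on_bounded_sets_rhs: "lipschitz_on_bounded_sets (rhs a b c)"
proof -
  interpret mm: bounded_bilinear "(**) :: real^3^3 \<Rightarrow> real^3^3 \<Rightarrow> real^3^3"
    by (rule bounded_bilinear_matrix_mult)
  note lin = lipschitz_on_bounded_sets_bounded_linear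
  note bil = lipschitz_on_bounded_sets_bilinear
  have const: "lipschitz_on_bounded_sets (\<lambda>x::real^3^3. k)"
    for k :: "'z::real_normed_vector"
    unfolding lipschitz_on_bounded_sets_def using lipschitz_on_constant by blast
  have id: "lipschitz_on_bounded_sets (\<lambda>Q::real^3^3. Q)"
    by (rule lin) (rule bounded_linear_ident)
  have comm: "lipschitz_on_bounded_sets (commutator W)"
    unfolding commutator_def[abs_def]
    by (intro lin bounded_linear_sub bounded_bilinear.bounded_linear_right
        bounded_bilinear.bounded_linear_left bounded_bilinear_matrix_mult)
  have sq: "lipschitz_on_bounded_sets (\<lambda>Q::real^3^3. Q ** Q)"
    by (rule bil[OF bounded_bilinear_matrix_mult id id])
  have "bounded_bilinear (\<lambda>A B::real^3^3. trace (A ** B))"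
    unfolding bilinear_conv_bounded_bilinear[symmetric] bilinear_def
    by (auto intro!: linearI simp: mm.add_left mm.add_right mm.scaleR_left mm.scaleR_right
        linear_add[OF linear_trace] linear_scale[OF linear_trace])
  from bil[OF this id id] have nsq: "lipschitz_on_bounded_sets normsq"
    by (simp add: normsq_def[abs_def])
  have nsq': "lipschitz_on_bounded_sets (\<lambda>Q. k * normsq Q)" for k
    by (rule bil[OF bounded_bilinear_mult const nsq])
  have scaleR: "lipschitz_on_bounded_sets (\<lambda>Q. k *\<^sub>R F Q)"
    if "lipschitz_on_bounded_sets F" for k and F :: "real^3^3 \<Rightarrow> real^3^3"
    by (rule bil[OF bounded_bilinear_scaleR const that])
  show ?thesis
    unfolding rhs_def[abs_def]
    by (intro lipschitz_on_bounded_sets_diff lipschitz_on_bounded_sets_add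
        comm id sq scaleR bil[OF bounded_bilinear_scaleR nsq' const]
        bil[OF bounded_bilinear_scaleR nsq' id])
qed

text \<open>On unit vectors the projector \<open>v \<otimes> v\<close> is idempotent with trace 1, so the whole
  bulk term is the multiple \<open>a - b s / 3 + 2 c s\<^sup>2 / 3\<close> of the uniaxial tensor itself; the
  two admissible scalar order parameters are the roots of this quadratic.\<close>

lemma rhs_uniaxial:
  assumes s: "2 * c * s^2 - b * s + 3 * a = 0" and v: "norm v = 1"
  shows "rhs a b c (s *\<^sub>R (tensor v v - (1/3) *\<^sub>R mat 1))
       = s *\<^sub>R commutator W (tensor v v)"
proof -
  interpret mm: bounded_bilinear "(**) :: real^3^3 \<Rightarrow> real^3^3 \<Rightarrow> real^3^3"
    by (rule bounded_bilinear_matrix_mult)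
  define A where "A = tensor v v"
  define U where "U = s *\<^sub>R (A - (1/3) *\<^sub>R mat 1)"
  have vv: "v$1 * v$1 + v$2 * v$2 + v$3 * v$3 = 1"
    using v by (simp add: norm_eq_1 inner_vec_def sum_3)
  have trA: "trace A = 1"
    using vv by (simp add: A_def tensor_def trace_def sum_3)
  have "(A ** A) $ i $ j = v$i * (v$1 * v$1 + v$2 * v$2 + v$3 * v$3) * v$j" for i j
    by (simp add: A_def tensor_def matrix_matrix_mult_def sum_3 algebra_simps)
  then have AA: "A ** A = A"
    by (simp add: vv vec_eq_iff A_def tensor_def)
  have "U ** U = (s^2) *\<^sub>R (A ** A - (2/3) *\<^sub>R A + (1/9) *\<^sub>R mat 1)"
    by (simp add: U_def mm.diff_left mm.diff_right mm.scaleR_left mm.scaleR_right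
        power2_eq_square vec_eq_iff algebra_simps)
  then have UU: "U ** U = (s^2 / 3) *\<^sub>R A + (s^2 / 9) *\<^sub>R mat 1"
    by (simp add: AA vec_eq_iff algebra_simps)
  have nU: "normsq U = 2/3 * s^2"
    using trA by (simp add: normsq_def UU linear_add[OF linear_trace]
        linear_scale[OF linear_trace] trace_I)
  have comm: "commutator W U = s *\<^sub>R commutator W A"
    by (simp add: U_def commutator_def mm.diff_left mm.diff_right mm.scaleR_left mm.scaleR_right
        algebra_simps)
  have "a *\<^sub>R U - b *\<^sub>R (U ** U - (1/3 * normsq U) *\<^sub>R mat 1) + (c * normsq U) *\<^sub>R U
      = (a - b * s / 3 + 2 / 3 * c * s^2) *\<^sub>R U"
    unfolding nU UU by (simp add: U_def vec_eq_iff field_simps power2_eq_square)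
  also have "a - b * s / 3 + 2 / 3 * c * s^2 = 0"
    using s by (simp add: field_simps)
  finally show ?thesis
    unfolding rhs_def A_def[symmetric] U_def[symmetric] by (simp add: comm)
qed

text \<open>The commutator with \<open>W\<close> is the infinitesimal rotation of tensors, since \<open>W\<close> is
  antisymmetric.\<close>

lemma commutator_W_tensor:
  "commutator W (tensor v w) = tensor (W *v v) w + tensor v (W *v w)"
  by (simp add: commutator_def tensor_def W_def matrix_matrix_mult_def matrix_vector_mult_def
      vec_eq_iff forall_3 sum_3)

definition rotated :: "real^3 \<Rightarrow> real \<Rightarrow> real^3" where
  "rotated n t = vector [n$1 * cos t + n$2 * sin t, - n$1 * sin t + n$2 * cos t, n$3]"

lemma norm_rotated: "norm (rotated n t) = norm n"
proof -
  have "rotated n t \<bullet> rotated n t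
      = ((n$1)^2 + (n$2)^2) * ((sin t)^2 + (cos t)^2) + (n$3)^2"
    unfolding inner_vec_def sum_3 rotated_def vector_3 inner_real_def by algebra
  also have "\<dots> = (n$1)^2 + (n$2)^2 + (n$3)^2" by simp
  also have "\<dots> = n \<bullet> n" by (simp add: inner_vec_def sum_3 power2_eq_square)
  finally show ?thesis by (simp add: norm_eq_sqrt_inner)
qed

lemma has_vector_derivative_rotated:
  "(rotated n has_vector_derivative W *v rotated n t) (at t)"
proof -
  have split: "rotated n = (\<lambda>t. cos t *\<^sub>R vector [n$1, n$2, 0] + sin t *\<^sub>R vector [n$2, - n$1, 0]
      + vector [0, 0, n$3])"
    by (simp add: fun_eq_iff rotated_def vec_eq_iff forall_3)
  have "(rotated n has_vector_derivative
      (- sin t) *\<^sub>R vector [n$1, n$2, 0] + cos t *\<^sub>R vector [n$2, - n$1, 0]) (at t)"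
    unfolding split by (auto intro!: derivative_eq_intros)
  also have "(- sin t) *\<^sub>R vector [n$1, n$2, 0] + cos t *\<^sub>R vector [n$2, - n$1, 0]
      = W *v rotated n t"
    by (simp add: rotated_def W_def matrix_vector_mult_def vec_eq_iff forall_3 sum_3)
  finally show ?thesis .
qed

lemma uniaxial_in_Q_tensors:
  assumes "norm v = 1"
  shows "s *\<^sub>R (tensor v v - (1/3) *\<^sub>R mat 1) \<in> Q_tensors"
proof -
  have "v$1 * v$1 + v$2 * v$2 + v$3 * v$3 = 1"
    using assms by (simp add: norm_eq_1 inner_vec_def sum_3)
  then show ?thesis
    by (auto simp: Q_tensors_def tensor_def transpose_def trace_def mat_def vec_eq_iff sum_3
        right_diff_distrib[symmetric] distrib_left[symmetric])
qed

theorem corollary2p2: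
  fixes a b c s :: real and n :: "real^3"
  assumes "b > 0" and "c > 0" and "b^2 - 24 * a * c > 0"
    and "s \<in> {(b + sqrt (b^2 - 24 * a * c)) / (4 * c), (b - sqrt (b^2 - 24 * a * c)) / (4 * c)}"
    and "n \<in> sphere 0 1"
  shows "\<exists>Q. is_solution a b c (s *\<^sub>R (tensor n n - (1/3) *\<^sub>R mat 1)) UNIV Q
           \<and> (\<forall>I P. is_solution a b c (s *\<^sub>R (tensor n n - (1/3) *\<^sub>R mat 1)) I P
                  \<longrightarrow> (\<forall>t\<in>I. P t = Q t))
           \<and> (\<exists>T>0. \<forall>t. Q (t + T) = Q t)
           \<and> (\<forall>t. let nt = vector [n$1 * cos t + n$2 * sin t, - n$1 * sin t + n$2 * cos t, n$3]
                  in Q t = s *\<^sub>R (tensor nt nt - (1/3) *\<^sub>R mat 1))"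
proof -
  have root: "2 * c * s^2 - b * s + 3 * a = 0"
  proof -
    have "discrim (2 * c) (- b) (3 * a) = b^2 - 24 * a * c"
      by (simp add: discrim_def)
    then show ?thesis
      using discriminant_iff[of "2 * c" s "- b" "3 * a"] assms(2-4) by auto
  qed
  define Q where "Q t = s *\<^sub>R (tensor (rotated n t) (rotated n t) - (1/3) *\<^sub>R mat 1)" for t
  have unit: "norm (rotated n t) = 1" for t
    using assms(5) by (simp add: norm_rotated)
  have Q0: "Q 0 = s *\<^sub>R (tensor n n - (1/3) *\<^sub>R mat 1)"
  proof -
    have "rotated n 0 = n" by (simp add: rotated_def vec_eq_iff forall_3)
    then show ?thesis by (simp add: Q_def)
  qed
  have Q': "(Q has_vector_derivative rhs a b c (Q t)) (at t)" for t
  proof -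
    note v' = has_vector_derivative_rotated[of n t]
    have "((\<lambda>t. tensor (rotated n t) (rotated n t)) has_vector_derivative
        commutator W (tensor (rotated n t) (rotated n t))) (at t)"
      using bounded_bilinear.has_vector_derivative[OF bounded_bilinear_tensor v' v']
      by (simp add: commutator_W_tensor add.commute)
    then have "(Q has_vector_derivative
        s *\<^sub>R commutator W (tensor (rotated n t) (rotated n t))) (at t)"
      unfolding Q_def[abs_def] by (auto intro!: derivative_eq_intros)
    then show ?thesis
      by (simp add: Q_def rhs_uniaxial[OF root unit])
  qed
  have sol: "is_solution a b c (Q 0) UNIV Q"
    using Q' uniaxial_in_Q_tensors[OF unit] by (auto simp: is_solution_def Q_def)
  have unique: "P t = Q t" if P: "is_solution a b c (Q 0) I P" and t: "t \<in> I" for I P t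
  proof (rule ode_unique_if_lipschitz_on_bounded_sets[OF lipschitz_on_bounded_sets_rhs])
    show "(P has_vector_derivative rhs a b c (P x)) (at x within I)" if "x \<in> I" for x
      using P that unfolding is_solution_def by blast
    show "(Q has_vector_derivative rhs a b c (Q x)) (at x within I)" for x
      using Q' has_vector_derivative_at_within by blast
  qed (use P t in \<open>auto simp: is_solution_def\<close>)
  have "Q (t + 2 * pi) = Q t" for t
    by (simp add: Q_def rotated_def)
  then have periodic: "\<exists>T>0. \<forall>t. Q (t + T) = Q t"
    by (intro exI[of _ "2 * pi"]) auto
  have formula: "\<forall>t. let nt = vector [n$1 * cos t + n$2 * sin t, - n$1 * sin t + n$2 * cos t, n$3]
      in Q t = s *\<^sub>R (tensor nt nt - (1/3) *\<^sub>R mat 1)"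
    by (simp only: Q_def rotated_def Let_def simp_thms)
  show ?thesis
    using sol unique periodic formula unfolding Q0 by blast
qed

end
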